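(* Let $q$ be a prime power, $m\ge 1$ an integer, and $f:\mathbb{F}_q^m\to\mathbb{F}_q$ a function such that for every $\omega\in\mathbb{F}_q^m$ there is some $\mathbf{x}\in\mathbb{F}_q^m\setminus\{\mathbf{0}\}$ with $f(\mathbf{x})\neq\omega\cdot\mathbf{x}$. Let $u\in\mathbb{F}_q$ with $u\neq 0$ and let $\mathbf{v}=\mathbf{0}\in\mathbb{F}_q^m$. Then the codeword $\mathbf{c}(u,\mathbf{v})$ is minimal in $\mathcal{C}_f$ if and only if there exists a basis $\{\alpha_1,\dots,\alpha_m\}$ of $\mathbb{F}_q^m$ such that $f(\alpha_1)=\cdots=f(\alpha_m)=0$.
   Context: For $\mathbf{x},\mathbf{y}\in\mathbb{F}_q^m$, $\mathbf{x}\cdot\mathbf{y}=\sum_i x_iy_i$. For $u\in\mathbb{F}_q$ and $\mathbf{v}\in\mathbb{F}_q^m$ put $\mathbf{c}(u,\mathbf{v})=(uf(\mathbf{x})+\mathbf{v}\cdot\mathbf{x})_{\mathbf{x}\in\mathbb{F}_q^m\setminus\{\mathbf{0}\}}\in\mathbb{F}_q^{q^m-1}$, and let $\mathcal{C}_f=\{\mathbf{c}(u,\mathbf{v}) : u\in\mathbb{F}_q,\ \mathbf{v}\in\mathbb{F}_q^m\}$; under the assumption on $f$ this is a $[q^m-1,m+1]_q$ linear code. The support of a vector is the set of its coordinate positions with nonzero entry; $\mathbf{b}\preceq\mathbf{c}$ ($\mathbf{c}$ covers $\mathbf{b}$) means that the support of $\mathbf{b}$ is contained in the support of $\mathbf{c}$.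 A codeword $\mathbf{c}$ of a linear code $\mathcal{C}$ is minimal in $\mathcal{C}$ if for every $\mathbf{b}\in\mathcal{C}$, $\mathbf{b}\preceq\mathbf{c}$ implies $\mathbf{b}=a\mathbf{c}$ for some $a\in\mathbb{F}_q$. *)

theory Defs
  imports "HOL-Analysis.Analysis" "HOL-Library.FuncSet"
begin

text \<open>
  The field \<open>F\<^sub>q\<close> is a finite field type \<open>'a\<close> with \<open>q = CARD('a)\<close>, and \<open>F\<^sub>q\<^sup>m\<close> is \<open>'a ^ 'm\<close>
  with \<open>m = CARD('m)\<close>.  A vector whose coordinates are indexed by a finite set \<open>I\<close> is a function
  in \<open>extensional I\<close>, that is, it has the value \<open>undefined\<close> outside \<open>I\<close>; thus equality of
  such functions is equality of vectors of length \<open>card I\<close>.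
\<close>

definition support :: "'i set \<Rightarrow> ('i \<Rightarrow> 'a::zero) \<Rightarrow> 'i set" where
  "support I c = {i \<in> I. c i \<noteq> 0}"

definition covers :: "'i set \<Rightarrow> ('i \<Rightarrow> 'a::zero) \<Rightarrow> ('i \<Rightarrow> 'a) \<Rightarrow> bool" where
  "covers I c b \<longleftrightarrow> support I b \<subseteq> support I c"

definition scale :: "'i set \<Rightarrow> 'a::times \<Rightarrow> ('i \<Rightarrow> 'a) \<Rightarrow> 'i \<Rightarrow> 'a" where
  "scale I a c = (\<lambda>i\<in>I. a * c i)"

definition linear_code :: "'i set \<Rightarrow> ('i \<Rightarrow> 'a::field) set \<Rightarrow> bool" where
  "linear_code I C \<longleftrightarrow>
     finite I \<and> C \<subseteq> extensional I \<and> (\<lambda>i\<in>I. 0) \<in> C \<and>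
     (\<forall>b\<in>C. \<forall>c\<in>C. (\<lambda>i\<in>I. b i + c i) \<in> C) \<and>
     (\<forall>a. \<forall>c\<in>C. scale I a c \<in> C)"

definition minimal_codeword :: "'i set \<Rightarrow> ('i \<Rightarrow> 'a::field) set \<Rightarrow> ('i \<Rightarrow> 'a) \<Rightarrow> bool" where
  "minimal_codeword I C c \<longleftrightarrow>
     c \<in> C \<and> (\<forall>b\<in>C. covers I c b \<longrightarrow> (\<exists>a. b = scale I a c))"

abbreviation nonzero_vectors :: "('a::field ^ 'm) set" where
  "nonzero_vectors \<equiv> UNIV - {0}"

definition codeword :: "('a::field ^ 'm \<Rightarrow> 'a) \<Rightarrow> 'a \<Rightarrow> 'a ^ 'm \<Rightarrow> 'a ^ 'm \<Rightarrow> 'a" where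
  "codeword f u v = (\<lambda>x\<in>nonzero_vectors. u * f x + scalar_product v x)"

definition code_of :: "('a::field ^ 'm \<Rightarrow> 'a) \<Rightarrow> ('a ^ 'm \<Rightarrow> 'a) set" where
  "code_of f = {codeword f u v | u v. True}"

lemma codeword_add:
  "(\<lambda>x\<in>nonzero_vectors. codeword f u v x + codeword f u' v' x) = codeword f (u + u') (v + v')"
  by (auto simp: codeword_def scalar_product_def restrict_def fun_eq_iff algebra_simps sum.distrib)

lemma codeword_scale:
  "scale nonzero_vectors a (codeword f u v) = codeword f (a * u) (a *s v)"
  by (auto simp: codeword_def scale_def scalar_product_def restrict_def fun_eq_iff algebra_simps
      sum_distrib_left)

lemma linear_code_code_of:
  fixes f :: "'a::{field,finite} ^ 'm \<Rightarrow> 'a"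
  shows "linear_code nonzero_vectors (code_of f)"
proof -
  have "(\<lambda>x\<in>nonzero_vectors. 0) = codeword f 0 0"
    by (auto simp: codeword_def scalar_product_def restrict_def fun_eq_iff)
  moreover have "codeword f u v \<in> code_of f" for u v
    by (auto simp: code_of_def)
  moreover have "code_of f \<subseteq> extensional nonzero_vectors"
    by (auto simp: code_of_def codeword_def)
  ultimately show ?thesis
    unfolding linear_code_def by (auto simp: code_of_def codeword_add codeword_scale)
qed

end

theory Submission
  imports Defs
begin

text \<open>
  Since \<open>v = 0\<close>, the codeword \<open>c(u, 0)\<close> vanishes exactly on the nonzero zeros of \<open>f\<close>.  If the zeros
  span, every covered \<open>c(u', v')\<close> has \<open>v'\<close> orthogonal to a spanning set, so \<open>v' = 0\<close>.  If they do not
  span, some \<open>w \<noteq> 0\<close> is orthogonal to all of them, and \<open>c(0, w)\<close> is covered by \<open>c(u, 0)\<close> but is not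
  a multiple of it, because \<open>f\<close> is not linear.
\<close>

lemma scalar_product_axis: "scalar_product v (axis i (1::'a::field)) = v $ i"
proof -
  have "scalar_product v (axis i 1) = (\<Sum>j\<in>UNIV. if j = i then v $ j else 0)"
    unfolding scalar_product_def by (intro sum.cong) (auto simp: axis_def)
  then show ?thesis
    by simp
qed

lemma scalar_product_row: "scalar_product (A $ i) x = (A *v x) $ i"
  by (simp add: scalar_product_def matrix_vector_mult_def)

lemma scalar_product_scale_left: "scalar_product (a *s v) x = a * scalar_product v (x :: 'a::field ^ 'm)"
  by (simp add: scalar_product_def sum_distrib_left mult.assoc)

lemma scalar_product_zero_left [simp]: "scalar_product 0 (x :: 'a::field ^ 'm) = 0"
  by (simp add: scalar_product_def)

lemma scalar_product_zero_right [simp]: "scalar_product x (0 :: 'a::field ^ 'm) = 0"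
  by (simp add: scalar_product_def)

text \<open>The unit vectors are nonzero and already read off every coordinate of \<open>v\<close>.
  Only nonzero \<open>x\<close> are assumed because codewords have no entry at position 0.\<close>

lemma zero_if_orthogonal_to_nonzero_vectors:
  fixes v :: "'a::field ^ 'm"
  assumes "\<And>x. x \<noteq> 0 \<Longrightarrow> scalar_product v x = 0"
  shows "v = 0"
proof -
  have "scalar_product v (axis i 1) = 0" for i
    using assms[of "axis i 1"] by (simp add: axis_eq_0_iff)
  then show ?thesis
    by (simp add: scalar_product_axis vec_eq_iff)
qed

lemma orthogonal_to_span:
  fixes v :: "'a::field ^ 'm"
  assumes "x \<in> vec.span B" and "\<And>b. b \<in> B \<Longrightarrow> scalar_product v b = 0"
  shows "scalar_product v x = 0"
  using assms(1)
proof (induction rule: vec.span_induct_alt)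
  case base
  then show ?case by simp
next
  case (step c y z)
  have "scalar_product v (c *s y + z) = c * scalar_product v y + scalar_product v z"
    by (simp add: scalar_product_def sum_distrib_left sum.distrib algebra_simps)
  with step assms(2) show ?case by simp
qed

text \<open>A linear functional can vanish on \<open>Z\<close> and still be nonzero at a vector
  \<open>b\<close> outside the span. Such a functional is found as one coordinate of an
  endomorphism, so that a row of its matrix serves as \<open>w\<close>.\<close>

lemma ex_orthogonal_if_not_spanning:
  fixes Z :: "('a::field ^ 'm) set"
  assumes "vec.span Z \<noteq> UNIV"
  obtains w where "w \<noteq> 0" and "\<And>z. z \<in> Z \<Longrightarrow> scalar_product w z = 0"
proof -
  obtain b where b: "b \<notin> vec.span Z"
    using assms by blast
  obtain B where B: "B \<subseteq> Z" "vec.independent B" "Z \<subseteq> vec.span B"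
    using vec.maximal_independent_subset by blast
  have "b \<notin> vec.span B"
    using b vec.span_mono[OF B(1)] by blast
  then have ind: "vec.independent (insert b B)" and bB: "b \<notin> B" and b0: "b \<noteq> 0"
    using B(2) vec.span_base vec.span_zero by (auto simp: vec.independent_insert)
  \<comment> \<open>Values on the independent set \<open>insert b B\<close> can be prescribed
    freely: \<open>g\<close> kills \<open>B\<close> and fixes \<open>b\<close>.\<close>
  obtain g where g: "Vector_Spaces.linear (*s) (*s) g"
    and gB: "\<And>x. x \<in> insert b B \<Longrightarrow> g x = (if x = b then b else 0)"
    using vec.linear_independent_extend[OF ind, of "\<lambda>x. if x = b then b else 0"] by blast
  \<comment> \<open>Since \<open>g b = b\<close>, any coordinate where \<open>b\<close> is nonzero
    selects a row of \<open>matrix g\<close> that is not orthogonal to \<open>b\<close>.\<close>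
  obtain i where i: "b $ i \<noteq> 0"
    using b0 by (auto simp: vec_eq_iff)
  define w where "w = matrix g $ i"
  have w: "scalar_product w x = g x $ i" for x
    unfolding w_def scalar_product_row by (simp add: matrix_works[OF g])
  have "scalar_product w b \<noteq> 0"
    using gB[of b] i by (simp add: w)
  then have "w \<noteq> 0" by auto
  moreover have "scalar_product w z = 0" if "z \<in> Z" for z
  proof (rule orthogonal_to_span)
    show "z \<in> vec.span B"
      using B(3) that by blast
    show "scalar_product w y = 0" if "y \<in> B" for y
      using gB[of y] bB that by (auto simp: w)
  qed
  ultimately show ?thesis
    using that by blast
qed

text \<open>Inclusion of supports, read contrapositively as an inclusion of zero sets.\<close>

lemma covers_codeword_iff:
  "covers nonzero_vectors (codeword f u v) (codeword f u' v') \<longleftrightarrow>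
    (\<forall>x. x \<noteq> 0 \<longrightarrow> u * f x + scalar_product v x = 0 \<longrightarrow> u' * f x + scalar_product v' x = 0)"
  by (auto simp: covers_def support_def codeword_def)

theorem proposition3p3:
  fixes f :: "'a::{field,finite} ^ 'm \<Rightarrow> 'a"
    and u :: 'a and v :: "'a ^ 'm"
  assumes f_not_linear: "\<forall>\<omega>. \<exists>x\<in>nonzero_vectors. f x \<noteq> scalar_product \<omega> x"
    and "u \<noteq> 0" and "v = 0"
  shows "minimal_codeword nonzero_vectors (code_of f) (codeword f u v) \<longleftrightarrow>
    (\<exists>B. vec.independent B \<and> vec.span B = UNIV \<and> (\<forall>\<alpha>\<in>B. f \<alpha> = 0))"
proof
  assume min: "minimal_codeword nonzero_vectors (code_of f) (codeword f u v)"
  \<comment> \<open>\<open>Z\<close> may contain 0, which is not a position of the code; this does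
    not change its span.\<close>
  define Z where "Z = {x. f x = 0}"
  have "vec.span Z = UNIV"
  proof (rule ccontr)
    assume "vec.span Z \<noteq> UNIV"
    then obtain w where w0: "w \<noteq> 0" and w: "\<And>z. z \<in> Z \<Longrightarrow> scalar_product w z = 0"
      by (rule ex_orthogonal_if_not_spanning) blast
    have "covers nonzero_vectors (codeword f u v) (codeword f 0 w)"
      using w \<open>u \<noteq> 0\<close> \<open>v = 0\<close> by (simp add: covers_codeword_iff Z_def)
    moreover have "codeword f 0 w \<in> code_of f"
      by (auto simp: code_of_def)
    ultimately obtain a where "codeword f 0 w = scale nonzero_vectors a (codeword f u v)"
      using min by (auto simp: minimal_codeword_def)
    then have eq: "scalar_product w x = a * u * f x" if "x \<noteq> 0" for x
      using that \<open>v = 0\<close> unfolding codeword_scale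
      by (auto simp: codeword_def fun_eq_iff dest: spec[of _ x])
    \<comment> \<open>With \<open>a = 0\<close>, \<open>w\<close> would be orthogonal to every
      nonzero vector and hence zero.\<close>
    have "a \<noteq> 0"
      using zero_if_orthogonal_to_nonzero_vectors[of w] eq w0 by auto
    \<comment> \<open>Dividing by \<open>a * u\<close> makes \<open>f\<close> a linear functional on
      the nonzero vectors, against \<open>f_not_linear\<close>.\<close>
    then have "f x = scalar_product (inverse (a * u) *s w) x" if "x \<noteq> 0" for x
      using eq[OF that] \<open>u \<noteq> 0\<close> by (simp add: scalar_product_scale_left field_simps)
    with f_not_linear show False by blast
  qed
  \<comment> \<open>A basis is extracted from the spanning zero set, so its members are zeros of
    \<open>f\<close>.\<close>
  moreover obtain B where "B \<subseteq> Z" "vec.independent B" "Z \<subseteq> vec.span B"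
    using vec.maximal_independent_subset by blast
  moreover from this have "vec.span Z \<subseteq> vec.span B"
    by (simp add: vec.span_minimal)
  ultimately show "\<exists>B. vec.independent B \<and> vec.span B = UNIV \<and> (\<forall>\<alpha>\<in>B. f \<alpha> = 0)"
    unfolding Z_def by blast
next
  assume "\<exists>B. vec.independent B \<and> vec.span B = UNIV \<and> (\<forall>\<alpha>\<in>B. f \<alpha> = 0)"
  then obtain B where span: "vec.span B = UNIV" and fB: "\<And>\<alpha>. \<alpha> \<in> B \<Longrightarrow> f \<alpha> = 0"
    by blast
  have "\<exists>a. codeword f u' v' = scale nonzero_vectors a (codeword f u v)"
    if cov: "covers nonzero_vectors (codeword f u v) (codeword f u' v')" for u' v'
  proof -
    \<comment> \<open>At a nonzero zero \<alpha> of \<open>f\<close>, the covering word has entry 0,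
      so the covered one does too, and that entry is just the product of \<open>v'\<close> with
      \<alpha>. Covering says nothing at 0, where the product vanishes anyway.\<close>
    have "scalar_product v' \<alpha> = 0" if "\<alpha> \<in> B" for \<alpha>
      using cov fB[OF that] \<open>v = 0\<close> by (cases "\<alpha> = 0") (auto simp: covers_codeword_iff)
    then have "v' = 0"
      using orthogonal_to_span[of _ B v'] span by (intro zero_if_orthogonal_to_nonzero_vectors) auto
    \<comment> \<open>With both linear parts zero, the two codewords are \<open>u'\<close> and
      \<open>u\<close> times the values of \<open>f\<close>, which gives the ratio.\<close>
    then have "codeword f u' v' = scale nonzero_vectors (u' / u) (codeword f u v)"
      using \<open>u \<noteq> 0\<close> \<open>v = 0\<close> by (simp add: codeword_scale)
    then show ?thesis ..
  qed
  then show "minimal_codeword nonzero_vectors (code_of f) (codeword f u v)"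
    unfolding minimal_codeword_def code_of_def by blast
qed

end
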